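(* Let $T$ be a continuous linear operator defined on a Banach space $X$ which assumes values in $\mathrm{BMO}_d$ with norm $\|T\|_d$. Then $T$ maps $X$ continuously into $\mathrm{BMO}$ if and only if, for a constant $M$, for all integers $n,k$ (and all $f\in X$), $$\frac{1}{2^{n+1}}\Big|\int_{[(k-1)2^n,\,k2^n]}Tf(x)\,dx-\int_{[k2^n,\,(k+1)2^n]}Tf(x)\,dx\Big|\le M\,\|f\|_X,$$ and $\|T\|=\max(\|T\|_d,M)$.
   Context: All functions are on $\mathbb{R}$. For a locally integrable function $\varphi$ and a bounded interval $I$, let $\varphi_I=\frac1{|I|}\int_I\varphi(y)\,dy$. $\mathrm{BMO}$ is the space of locally integrable functions $\varphi$ with $\|\varphi\|_*=\sup_I\frac1{|I|}\int_I|\varphi(x)-\varphi_I|\,dx<\infty$, the supremum being taken over all bounded intervals $I$; modulo constants, $(\mathrm{BMO},\|\cdot\|_* )$ is a Banach space. $\mathrm{BMO}_d$ (dyadic BMO) is defined by restricting the intervals to be dyadic, that is, of the form $[k2^n,(k+1)2^n)$ with $k,n$ arbitrary integers; the supremum is then denoted $\|\varphi\|_{*,d}$, and modulo two constants (one for each side of the origin), $(\mathrm{BMO}_d,\|\cdot\|_{*,d})$ is a Banach space. $\|T\|_d$ denotes the norm of $T$ as an operator from $X$ into $\mathrm{BMO}_d$, and $\|T\|$ denotes the norm of $T$ as an operator from $X$ into $\mathrm{BMO}$.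
   Formalization: The norm identity fails for the least M (T r = r·1_[1/3,2/3)): it is stated for some admissible M, with ‖T‖ ≤ 16 max(‖T‖_d, M) for every admissible M; T is taken linear modulo one additive constant, since modulo two the displayed condition is undefined. *)

theory Defs
  imports "HOL-Analysis.Analysis"
begin

(* The values of the functions lie in a type 'b of sort {real_normed_field, euclidean_space};
   this covers real-valued and complex-valued functions alike. *)

definition locally_integrable :: "(real \<Rightarrow> 'b::{real_normed_field, euclidean_space}) \<Rightarrow> bool" where
  "locally_integrable \<phi> \<longleftrightarrow> (\<forall>a b. \<phi> absolutely_integrable_on {a..b})"

definition avg :: "real set \<Rightarrow> (real \<Rightarrow> 'b::{real_normed_field, euclidean_space}) \<Rightarrow> 'b" where
  "avg I \<phi> = (LINT x:I|lebesgue. \<phi> x) /\<^sub>R measure lebesgue I"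

definition mean_osc :: "real set \<Rightarrow> (real \<Rightarrow> 'b::{real_normed_field, euclidean_space}) \<Rightarrow> real" where
  "mean_osc I \<phi> = (LINT x:I|lebesgue. norm (\<phi> x - avg I \<phi>)) / measure lebesgue I"

(* Closed intervals stand for all nondegenerate bounded intervals:
   the averages do not see the endpoints. *)
definition bounded_intervals :: "real set set" where
  "bounded_intervals = {{a..b} | a b. a < b}"

definition dyadic_intervals :: "real set set" where
  "dyadic_intervals =
     {{of_int k * 2 powi n ..< (of_int k + 1) * 2 powi n} | (k::int) (n::int). True}"

(* For the family \<J> of all bounded intervals this is BMO, for the dyadic ones it is BMO_d. *)
definition bmo :: "real set set \<Rightarrow> (real \<Rightarrow> 'b::{real_normed_field, euclidean_space}) set" where
  "bmo \<J> = {\<phi>. locally_integrable \<phi> \<and> bdd_above ((\<lambda>I. mean_osc I \<phi>) ` \<J>)}"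

definition bmo_norm :: "real set set \<Rightarrow> (real \<Rightarrow> 'b::{real_normed_field, euclidean_space}) \<Rightarrow> real" where
  "bmo_norm \<J> \<phi> = (SUP I\<in>\<J>. mean_osc I \<phi>)"

definition eq_mod_const ::
    "(real \<Rightarrow> 'b::{real_normed_field, euclidean_space}) \<Rightarrow> (real \<Rightarrow> 'b) \<Rightarrow> bool" where
  "eq_mod_const \<phi> \<psi> \<longleftrightarrow> (\<exists>c. AE x in lebesgue. \<phi> x = \<psi> x + c)"

(* Continuous linear operators into (bmo \<J>, bmo_norm \<J>), in analogy with bounded_linear.
   Linearity is required modulo one additive constant, also for BMO_d: modulo two constants
   (one for each half-line), neither membership in BMO nor a comparison of the integrals over
   intervals on opposite sides of the origin would make sense. *)
definition bounded_linear_into_bmo ::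
    "real set set \<Rightarrow> ('x::real_normed_vector \<Rightarrow> real \<Rightarrow> 'b::{real_normed_field, euclidean_space}) \<Rightarrow> bool" where
  "bounded_linear_into_bmo \<J> T \<longleftrightarrow>
     (\<forall>f. T f \<in> bmo \<J>) \<and>
     (\<forall>f g. eq_mod_const (T (f + g)) (\<lambda>x. T f x + T g x)) \<and>
     (\<forall>r f. eq_mod_const (T (r *\<^sub>R f)) (\<lambda>x. r *\<^sub>R T f x)) \<and>
     (\<exists>K. \<forall>f. bmo_norm \<J> (T f) \<le> K * norm f)"

(* The operator norm, in analogy with onorm. *)
definition bmo_onorm ::
    "real set set \<Rightarrow> ('x::real_normed_vector \<Rightarrow> real \<Rightarrow> 'b::{real_normed_field, euclidean_space}) \<Rightarrow> real" where
  "bmo_onorm \<J> T = (SUP f. bmo_norm \<J> (T f) / norm f)"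

definition adjacent_dyadic_bound ::
    "('x::real_normed_vector \<Rightarrow> real \<Rightarrow> 'b::{real_normed_field, euclidean_space}) \<Rightarrow> real \<Rightarrow> bool" where
  "adjacent_dyadic_bound T M \<longleftrightarrow>
     (\<forall>(n::int) (k::int) f.
        1 / 2 powi (n + 1) *
          norm ((LINT x:{(of_int k - 1) * 2 powi n .. of_int k * 2 powi n}|lebesgue. T f x)
              - (LINT x:{of_int k * 2 powi n .. (of_int k + 1) * 2 powi n}|lebesgue. T f x))
        \<le> M * norm f)"

end

theory Submission
  imports Defs
begin

text \<open>
  The left-hand side of the adjacency condition is half the distance between the averages
  \<open>m\<^sub>1\<close>, \<open>m\<^sub>2\<close> of \<open>T f\<close> over two neighbouring dyadic intervals of equal length.  Subtracting the
  average over their union \<open>J\<close> from \<open>T f\<close> does not change \<open>m\<^sub>1 - m\<^sub>2\<close>, so half the distance is at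
  most the mean oscillation over \<open>J\<close> (\<open>half_jump_le_mean_osc\<close>).  Hence boundedness into BMO yields
  the condition with \<open>M\<close> equal to the norm of \<open>T\<close> into BMO.  As this norm dominates the norm into
  dyadic BMO, this choice of \<open>M\<close> also gives the equality of the norm with the maximum.

  Conversely, every bounded interval \<open>I\<close> lies in the union of two neighbouring dyadic intervals
  of a common length less than \<open>2 |I|\<close> (\<open>dyadic_cover\<close>).  Up to a factor \<open>2\<close>, the average in the
  mean oscillation over \<open>I\<close> may be replaced by any constant (\<open>mean_osc_le_constant\<close>).  With the
  constant \<open>(m\<^sub>1 + m\<^sub>2) / 2\<close>, the oscillation over \<open>I\<close> is controlled by the two dyadic oscillations
  and the half distance of \<open>m\<^sub>1\<close> and \<open>m\<^sub>2\<close>; this gives the factor \<open>2 * (2 * 2 + 1) = 10\<close>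
  (\<open>mean_osc_le_of_dyadic\<close>).
\<close>

section \<open>Mean oscillation over intervals\<close>

lemma locally_integrable_diff_const:
  assumes "locally_integrable \<phi>"
  shows "(\<lambda>x. \<phi> x - c) absolutely_integrable_on {a..b}"
  using assms unfolding locally_integrable_def
  by (intro set_integral_diff) auto

lemma locally_integrable_integrable_on:
  assumes "locally_integrable \<phi>"
  shows "\<phi> integrable_on {a..b}"
    and "(\<lambda>x. \<phi> x - c) integrable_on {a..b}"
    and "(\<lambda>x. norm (\<phi> x - c)) integrable_on {a..b}"
  using locally_integrable_diff_const[OF assms, where c = 0]
    locally_integrable_diff_const[OF assms, where c = c]
  by (auto simp: absolutely_integrable_on_def)

lemma integral_diff_const:
  assumes "locally_integrable \<phi>" "a \<le> b"
  shows "integral {a..b} (\<lambda>x. \<phi> x - c) = integral {a..b} \<phi> - (b - a) *\<^sub>R c"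
  using assms locally_integrable_integrable_on(1)[OF assms(1)]
  by (subst Henstock_Kurzweil_Integration.integral_diff) auto

lemma set_integral_interval_eq_integral:
  fixes g :: "real \<Rightarrow> 'b::euclidean_space"
  assumes "g absolutely_integrable_on {a..b}"
  shows "(LINT x:{a..b}|lebesgue. g x) = integral {a..b} g"
    and "(LINT x:{a..<b}|lebesgue. g x) = integral {a..b} g"
proof -
  show "(LINT x:{a..b}|lebesgue. g x) = integral {a..b} g"
    using assms by (rule set_lebesgue_integral_eq_integral)
  have "g absolutely_integrable_on {a..<b}"
    using assms by (rule set_integrable_subset) auto
  then have "(LINT x:{a..<b}|lebesgue. g x) = integral {a..<b} g"
    by (rule set_lebesgue_integral_eq_integral)
  also have "\<dots> = integral {a..b} g"
    by (rule integral_spike_set; rule negligible_subset[of "{b}"]) auto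
  finally show "(LINT x:{a..<b}|lebesgue. g x) = integral {a..b} g" .
qed

lemma avg_interval:
  assumes "locally_integrable \<phi>" "a < b"
  shows "avg {a..b} \<phi> = integral {a..b} \<phi> /\<^sub>R (b - a)"
    and "avg {a..<b} \<phi> = integral {a..b} \<phi> /\<^sub>R (b - a)"
  using assms set_integral_interval_eq_integral[where g = \<phi> and a = a and b = b]
  by (simp_all add: avg_def locally_integrable_def)

lemma mean_osc_interval:
  assumes "locally_integrable \<phi>" "a < b"
  shows "mean_osc {a..b} \<phi> = integral {a..b} (\<lambda>x. norm (\<phi> x - avg {a..b} \<phi>)) / (b - a)"
    and "mean_osc {a..<b} \<phi> = mean_osc {a..b} \<phi>"
proof -
  have "(\<lambda>x. norm (\<phi> x - c)) absolutely_integrable_on {a..b}" for c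
    using locally_integrable_diff_const[OF assms(1)] by (rule set_integrable_norm)
  note * = set_integral_interval_eq_integral[OF this]
  show "mean_osc {a..b} \<phi> = integral {a..b} (\<lambda>x. norm (\<phi> x - avg {a..b} \<phi>)) / (b - a)"
    and "mean_osc {a..<b} \<phi> = mean_osc {a..b} \<phi>"
    using assms by (simp_all add: mean_osc_def * avg_interval)
qed

text \<open>The average is, up to a factor \<open>2\<close>, the best approximation in mean by a constant.\<close>

lemma mean_osc_le_constant:
  assumes \<phi>: "locally_integrable \<phi>" and ab: "a < b"
  shows "mean_osc {a..b} \<phi> \<le> 2 * integral {a..b} (\<lambda>x. norm (\<phi> x - c)) / (b - a)"
proof -
  let ?m = "avg {a..b} \<phi>" and ?N = "integral {a..b} (\<lambda>x. norm (\<phi> x - c))"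
  note int = locally_integrable_integrable_on[OF \<phi>]
  have "(b - a) *\<^sub>R (?m - c) = integral {a..b} (\<lambda>x. \<phi> x - c)"
    using ab by (simp add: avg_interval[OF \<phi> ab] integral_diff_const[OF \<phi>] scaleR_diff_right)
  then have "(b - a) * norm (?m - c) = norm (integral {a..b} (\<lambda>x. \<phi> x - c))"
    using ab by (metis abs_of_pos diff_gt_0_iff_gt norm_scaleR)
  also have "\<dots> \<le> ?N"
    by (rule integral_norm_bound_integral) (use int in auto)
  finally have m: "(b - a) * norm (?m - c) \<le> ?N" .
  have "integral {a..b} (\<lambda>x. norm (\<phi> x - ?m)) \<le> integral {a..b} (\<lambda>x. norm (\<phi> x - c) + norm (?m - c))"
  proof (rule integral_le)
    show "norm (\<phi> x - ?m) \<le> norm (\<phi> x - c) + norm (?m - c)" for x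
      using norm_triangle_ineq4[of "\<phi> x - c" "?m - c"] by simp
  qed (auto intro!: int integrable_add)
  also have "\<dots> = ?N + (b - a) * norm (?m - c)"
    using ab by (subst Henstock_Kurzweil_Integration.integral_add) (auto simp: int)
  finally have "integral {a..b} (\<lambda>x. norm (\<phi> x - ?m)) \<le> 2 * ?N"
    using m by simp
  then show ?thesis
    using ab by (simp add: mean_osc_interval[OF \<phi> ab] divide_right_mono)
qed

lemma half_jump_le_mean_osc:
  assumes \<phi>: "locally_integrable \<phi>" and h: "h > 0"
  shows "norm (integral {c-h..c} \<phi> - integral {c..c+h} \<phi>) / (2 * h) \<le> mean_osc {c-h..c+h} \<phi>"
proof -
  let ?m = "avg {c-h..c+h} \<phi>" and ?g = "\<lambda>x. norm (\<phi> x - avg {c-h..c+h} \<phi>)"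
  note int = locally_integrable_integrable_on[OF \<phi>]
  have bound: "norm (integral {u..v} (\<lambda>x. \<phi> x - ?m)) \<le> integral {u..v} ?g" for u v
    by (rule integral_norm_bound_integral) (use int in auto)
  have comb: "integral {c-h..c} ?g + integral {c..c+h} ?g = integral {c-h..c+h} ?g"
    by (rule Henstock_Kurzweil_Integration.integral_combine) (use h int(3) in auto)
  \<comment> \<open>Subtracting a constant from \<open>\<phi>\<close> does not change the difference of the two integrals.\<close>
  have "integral {c-h..c} \<phi> - integral {c..c+h} \<phi>
      = integral {c-h..c} (\<lambda>x. \<phi> x - ?m) - integral {c..c+h} (\<lambda>x. \<phi> x - ?m)"
    using h by (simp add: integral_diff_const[OF \<phi>])
  also have "norm \<dots> \<le> integral {c-h..c+h} ?g"
    using norm_triangle_ineq4 bound[of "c-h" c] bound[of c "c+h"] unfolding comb[symmetric]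
    by (meson add_mono order_trans)
  finally show ?thesis
    using h by (simp add: mean_osc_interval[OF \<phi>] divide_right_mono)
qed

section \<open>Comparison with dyadic intervals\<close>

lemma dyadic_cover:
  fixes a b :: real
  assumes "a < b"
  obtains n k :: int where
    "(of_int k - 1) * 2 powi n \<le> a" "b \<le> (of_int k + 1) * 2 powi n" "2 powi n < 2 * (b - a)"
proof -
  define n where "n = \<lceil>log 2 (b - a)\<rceil>"
  define h :: real where "h = 2 powi n"
  define k where "k = \<lfloor>a / h\<rfloor> + 1"
  have h: "h = 2 powr of_int n" "h > 0"
    by (simp_all add: h_def powr_real_of_int')
  have ba: "b - a = 2 powr log 2 (b - a)"
    using assms by simp
  have "b - a \<le> h"
    unfolding h by (subst ba, rule powr_mono) (simp_all add: n_def)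
  moreover have "h < 2 * (b - a)"
  proof -
    have "h < 2 powr (log 2 (b - a) + 1)"
      unfolding h by (rule powr_less_mono) (simp_all add: n_def, linarith)
    then show ?thesis
      using assms by (simp add: powr_add)
  qed
  moreover have "(of_int k - 1) * h \<le> a" "a < of_int k * h"
    using h(2) floor_divide_lower[of h a] floor_divide_upper[of h a] by (simp_all add: k_def)
  ultimately show ?thesis
    by (intro that[of k n]) (simp_all add: h_def algebra_simps)
qed

text \<open>
  The interval \<open>{a..b}\<close> lies in two neighbouring dyadic intervals of length \<open>h\<close>.  The bound \<open>D\<close>
  serves both for the dyadic oscillations and for half the distance of the two averages.
\<close>

lemma mean_osc_le_of_dyadic:
  fixes n k :: int
  defines "h \<equiv> 2 powi n"
  assumes \<phi>: "locally_integrable \<phi>" and ab: "a < b"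
    and cover: "(of_int k - 1) * h \<le> a" "b \<le> (of_int k + 1) * h" and h2: "h < 2 * (b - a)"
    and D: "\<And>I. I \<in> dyadic_intervals \<Longrightarrow> mean_osc I \<phi> \<le> D"
    and jump: "norm (integral {(of_int k - 1) * h..of_int k * h} \<phi>
                 - integral {of_int k * h..(of_int k + 1) * h} \<phi>) / (2 * h) \<le> D"
  shows "mean_osc {a..b} \<phi> \<le> 10 * D"
proof -
  define p q r where "p = (of_int k - 1) * h" and "q = of_int k * h" and "r = (of_int k + 1) * h"
  have h: "h > 0" by (simp add: h_def)
  have pqr: "q - p = h" "r - q = h"
    by (simp_all add: p_def q_def r_def algebra_simps)
  then have lt: "p < q" "q < r" using h by auto
  define m\<^sub>1 where "m\<^sub>1 = avg {p..q} \<phi>"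
  define m\<^sub>2 where "m\<^sub>2 = avg {q..r} \<phi>"
  define c where "c = (m\<^sub>1 + m\<^sub>2) /\<^sub>R 2"
  note int = locally_integrable_integrable_on[OF \<phi>]
  have dyadic: "{p..<q} \<in> dyadic_intervals" "{q..<r} \<in> dyadic_intervals"
    unfolding dyadic_intervals_def p_def q_def r_def h_def
    by (rule CollectI, rule exI[of _ "k - 1"], rule exI[of _ n], simp)
       (rule CollectI, rule exI[of _ "k"], rule exI[of _ n], simp)
  have "norm (m\<^sub>1 - m\<^sub>2) = norm (integral {p..q} \<phi> - integral {q..r} \<phi>) / h"
    using h lt by (simp add: m\<^sub>1_def m\<^sub>2_def avg_interval[OF \<phi>] pqr divide_inverse
        flip: scaleR_diff_right)
  then have half: "norm (m\<^sub>1 - m\<^sub>2) / 2 \<le> D"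
    using jump by (simp add: p_def q_def r_def mult.commute)
  have "m\<^sub>1 - c = (m\<^sub>1 - m\<^sub>2) /\<^sub>R 2" "m\<^sub>2 - c = (m\<^sub>2 - m\<^sub>1) /\<^sub>R 2"
    unfolding c_def by (simp_all add: algebra_simps flip: scaleR_add_left)
  then have dist: "norm (m\<^sub>1 - c) \<le> D" "norm (m\<^sub>2 - c) \<le> D"
    using half by (simp_all add: norm_minus_commute)
  have piece: "integral {u..v} (\<lambda>x. norm (\<phi> x - m)) \<le> h * D"
    if "m = avg {u..v} \<phi>" "u < v" "v - u = h" "{u..<v} \<in> dyadic_intervals" for u v m
    using D[OF that(4)] that h mean_osc_interval[OF \<phi> that(2)] by (simp add: field_simps)
  \<comment> \<open>The distance of \<open>\<phi>\<close> from its average over whichever of \<open>{p..q}\<close>, \<open>{q..r}\<close> contains the point.\<close>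
  define g where "g x = (if x \<le> q then norm (\<phi> x - m\<^sub>1) else norm (\<phi> x - m\<^sub>2))" for x
  have g1: "(g has_integral integral {p..q} (\<lambda>x. norm (\<phi> x - m\<^sub>1))) {p..q}"
    by (rule has_integral_eq[OF _ integrable_integral[OF int(3)]]) (simp add: g_def)
  have g2: "(g has_integral integral {q..r} (\<lambda>x. norm (\<phi> x - m\<^sub>2))) {q..r}"
    by (rule has_integral_spike_finite[OF _ _ integrable_integral[OF int(3)], of "{q}"])
       (auto simp: g_def)
  have g: "(g has_integral integral {p..q} (\<lambda>x. norm (\<phi> x - m\<^sub>1)) + integral {q..r} (\<lambda>x. norm (\<phi> x - m\<^sub>2))) {p..r}"
    using lt by (intro has_integral_combine[OF _ _ g1 g2]) auto
  have sub: "{a..b} \<subseteq> {p..r}"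
    using cover by (auto simp: p_def r_def)
  have gab: "g integrable_on {a..b}"
    using integrable_on_subinterval[OF has_integral_integrable[OF g] sub] .
  have "integral {a..b} g \<le> integral {p..r} g"
    by (rule integral_subset_le[OF sub gab has_integral_integrable[OF g]]) (simp add: g_def)
  also have "\<dots> \<le> 2 * h * D"
    using piece[OF m\<^sub>1_def] piece[OF m\<^sub>2_def] pqr lt dyadic integral_unique[OF g] by simp
  also have "\<dots> \<le> 4 * (b - a) * D"
    using h2 order_trans[OF norm_ge_zero dist(1)] by (intro mult_right_mono) auto
  finally have ig: "integral {a..b} g \<le> 4 * (b - a) * D" .
  have "integral {a..b} (\<lambda>x. norm (\<phi> x - c)) \<le> integral {a..b} (\<lambda>x. g x + D)"
  proof (rule integral_le)
    show "norm (\<phi> x - c) \<le> g x + D" for x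
      using norm_triangle_ineq[of "\<phi> x - m\<^sub>1" "m\<^sub>1 - c"] norm_triangle_ineq[of "\<phi> x - m\<^sub>2" "m\<^sub>2 - c"] dist
      by (auto simp: g_def)
  qed (auto intro!: int integrable_add gab)
  also have "\<dots> = integral {a..b} g + (b - a) * D"
    using ab by (subst Henstock_Kurzweil_Integration.integral_add) (auto simp: gab)
  also have "\<dots> \<le> 5 * D * (b - a)"
    using ig by (simp add: algebra_simps)
  finally have "integral {a..b} (\<lambda>x. norm (\<phi> x - c)) / (b - a) \<le> 5 * D"
    using ab by (simp add: divide_le_eq)
  then show ?thesis
    using mean_osc_le_constant[OF \<phi> ab, of c] by simp
qed

section \<open>BMO norms and operator norms\<close>

lemma mean_osc_nonneg: "mean_osc I \<phi> \<ge> 0"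
  unfolding mean_osc_def set_lebesgue_integral_def
  by (intro divide_nonneg_nonneg integral_nonneg_AE) auto

lemma mean_osc_le_bmo_norm:
  assumes "\<phi> \<in> bmo \<J>" "I \<in> \<J>"
  shows "mean_osc I \<phi> \<le> bmo_norm \<J> \<phi>"
  using assms unfolding bmo_def bmo_norm_def by (auto intro: cSUP_upper)

lemma bmo_norm_le:
  assumes "\<J> \<noteq> {}" "\<And>I. I \<in> \<J> \<Longrightarrow> mean_osc I \<phi> \<le> C"
  shows "bmo_norm \<J> \<phi> \<le> C"
  unfolding bmo_norm_def using assms by (intro cSUP_least) auto

lemma bounded_intervals_nonempty: "bounded_intervals \<noteq> {}"
  using zero_less_one unfolding bounded_intervals_def by blast

lemma dyadic_intervals_nonempty: "dyadic_intervals \<noteq> {}"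
  unfolding dyadic_intervals_def by blast

lemma dyadic_bmo_norm_le:
  assumes "\<phi> \<in> bmo bounded_intervals"
  shows "bmo_norm dyadic_intervals \<phi> \<le> bmo_norm bounded_intervals \<phi>"
proof (rule bmo_norm_le[OF dyadic_intervals_nonempty])
  fix I assume "I \<in> dyadic_intervals"
  then obtain a b where I: "I = {a..<b}" "a < b"
    unfolding dyadic_intervals_def by (fastforce simp: algebra_simps)
  have "{a..b} \<in> bounded_intervals"
    using I(2) unfolding bounded_intervals_def by blast
  then show "mean_osc I \<phi> \<le> bmo_norm bounded_intervals \<phi>"
    using assms mean_osc_le_bmo_norm mean_osc_interval(2)[OF _ I(2), of \<phi>] I(1)
    by (auto simp: bmo_def)
qed

lemma bmo_onorm_le:
  assumes "\<And>f. bmo_norm \<J> (T f) \<le> C * norm f" "C \<ge> 0"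
  shows "bmo_onorm \<J> T \<le> C"
  unfolding bmo_onorm_def
proof (rule cSUP_least)
  show "bmo_norm \<J> (T f) / norm f \<le> C" for f
    using assms by (cases "f = 0") (auto simp: divide_le_eq)
qed simp

lemma bmo_onorm_bound:
  assumes T: "bounded_linear_into_bmo \<J> T"
  shows "bmo_norm \<J> (T f) \<le> bmo_onorm \<J> T * norm f"
    and "bmo_onorm \<J> T \<ge> 0"
proof -
  obtain K where K: "\<And>f. bmo_norm \<J> (T f) \<le> K * norm f"
    using T unfolding bounded_linear_into_bmo_def by blast
  have "bmo_norm \<J> (T f) / norm f \<le> max K 0" for f
    using K[of f] by (cases "f = 0") (auto simp: divide_le_eq le_max_iff_disj)
  then have "bdd_above (range (\<lambda>f. bmo_norm \<J> (T f) / norm f))"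
    by (rule bdd_aboveI2)
  then have upper: "bmo_norm \<J> (T f) / norm f \<le> bmo_onorm \<J> T" for f
    unfolding bmo_onorm_def by (auto intro: cSUP_upper)
  \<comment> \<open>At \<open>f = 0\<close> the quotient is \<open>0\<close> by convention.\<close>
  show "bmo_onorm \<J> T \<ge> 0"
    using upper[of 0] by simp
  show "bmo_norm \<J> (T f) \<le> bmo_onorm \<J> T * norm f"
    using upper[of f] K[of f] by (cases "f = 0") (auto simp: divide_le_eq)
qed

lemma adjacent_dyadic_bound_iff:
  assumes "\<And>f. locally_integrable (T f)"
  shows "adjacent_dyadic_bound T M \<longleftrightarrow>
    (\<forall>(n::int) (k::int) f.
       norm (integral {(of_int k - 1) * 2 powi n..of_int k * 2 powi n} (T f)
           - integral {of_int k * 2 powi n..(of_int k + 1) * 2 powi n} (T f)) / (2 * 2 powi n)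
       \<le> M * norm f)"
proof -
  have eq: "(LINT x:{a..b}|lebesgue. T f x) = integral {a..b} (T f)" for f a b
    using assms by (intro set_integral_interval_eq_integral) (simp add: locally_integrable_def)
  show ?thesis
    unfolding adjacent_dyadic_bound_def eq by (simp add: power_int_add mult.commute)
qed

section \<open>Boundedness into BMO\<close>

lemma adjacent_dyadic_bound_bmo_onorm:
  assumes T: "bounded_linear_into_bmo bounded_intervals T"
  shows "adjacent_dyadic_bound T (bmo_onorm bounded_intervals T)"
proof -
  have mem: "T f \<in> bmo bounded_intervals" for f
    using T by (simp add: bounded_linear_into_bmo_def)
  then have loc: "locally_integrable (T f)" for f
    by (simp add: bmo_def)
  show ?thesis
    unfolding adjacent_dyadic_bound_iff[OF loc]
  proof (intro allI)
    fix n k :: int and f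
    define h c :: real where "h = 2 powi n" and "c = of_int k * h"
    have h: "h > 0" by (simp add: h_def)
    have ends: "(of_int k - 1) * h = c - h" "(of_int k + 1) * h = c + h"
      by (simp_all add: c_def algebra_simps)
    have J: "{c-h..c+h} \<in> bounded_intervals"
      using h unfolding bounded_intervals_def by force
    have "norm (integral {c-h..c} (T f) - integral {c..c+h} (T f)) / (2 * h)
        \<le> mean_osc {c-h..c+h} (T f)"
      by (rule half_jump_le_mean_osc[OF loc h])
    also have "\<dots> \<le> bmo_norm bounded_intervals (T f)"
      by (rule mean_osc_le_bmo_norm[OF mem J])
    also have "\<dots> \<le> bmo_onorm bounded_intervals T * norm f"
      by (rule bmo_onorm_bound[OF T])
    finally show "norm (integral {(of_int k - 1) * 2 powi n..of_int k * 2 powi n} (T f)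
           - integral {of_int k * 2 powi n..(of_int k + 1) * 2 powi n} (T f)) / (2 * 2 powi n)
       \<le> bmo_onorm bounded_intervals T * norm f"
      unfolding h_def[symmetric] ends c_def[symmetric] .
  qed
qed

lemma mean_osc_le_of_adjacent_dyadic_bound:
  assumes T: "bounded_linear_into_bmo dyadic_intervals T"
    and M: "adjacent_dyadic_bound T M" and I: "I \<in> bounded_intervals"
  shows "mean_osc I (T f) \<le> 10 * (max (bmo_onorm dyadic_intervals T) M * norm f)"
proof -
  let ?D = "max (bmo_onorm dyadic_intervals T) M * norm f"
  have mem: "T f \<in> bmo dyadic_intervals" for f
    using T by (simp add: bounded_linear_into_bmo_def)
  then have loc: "locally_integrable (T f)" for f
    by (simp add: bmo_def)
  obtain a b where ab: "I = {a..b}" "a < b"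
    using I unfolding bounded_intervals_def by blast
  obtain n k :: int where nk: "(of_int k - 1) * 2 powi n \<le> a"
      "b \<le> (of_int k + 1) * 2 powi n" "2 powi n < 2 * (b - a)"
    using dyadic_cover[OF ab(2)] by blast
  have le: "bmo_onorm dyadic_intervals T * norm f \<le> ?D" "M * norm f \<le> ?D"
    by (auto intro: mult_right_mono)
  show ?thesis
    unfolding ab(1)
  proof (rule mean_osc_le_of_dyadic[OF loc ab(2) nk])
    show "mean_osc J (T f) \<le> ?D" if "J \<in> dyadic_intervals" for J
      using mean_osc_le_bmo_norm[OF mem that] bmo_onorm_bound(1)[OF T] le(1) by (meson order_trans)
  qed (use M le(2) in \<open>auto simp: adjacent_dyadic_bound_iff[OF loc] intro: order_trans\<close>)
qed

lemma bounded_into_bmo_of_adjacent_dyadic_bound: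
  assumes T: "bounded_linear_into_bmo dyadic_intervals T" and M: "adjacent_dyadic_bound T M"
  shows "bounded_linear_into_bmo bounded_intervals T"
    and "bmo_onorm bounded_intervals T \<le> 10 * max (bmo_onorm dyadic_intervals T) M"
proof -
  let ?C = "10 * max (bmo_onorm dyadic_intervals T) M"
  have osc: "mean_osc I (T f) \<le> ?C * norm f" if "I \<in> bounded_intervals" for I f
    using mean_osc_le_of_adjacent_dyadic_bound[OF T M that] by (simp add: mult.assoc)
  have norm: "bmo_norm bounded_intervals (T f) \<le> ?C * norm f" for f
    by (rule bmo_norm_le[OF bounded_intervals_nonempty osc])
  have "T f \<in> bmo bounded_intervals" for f
    using T osc by (auto simp: bounded_linear_into_bmo_def bmo_def intro!: bdd_aboveI2)
  then show "bounded_linear_into_bmo bounded_intervals T"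
    using T norm unfolding bounded_linear_into_bmo_def by blast
  show "bmo_onorm bounded_intervals T \<le> ?C"
    by (rule bmo_onorm_le[OF norm]) (use bmo_onorm_bound(2)[OF T] in auto)
qed

lemma dyadic_bmo_onorm_le:
  assumes T: "bounded_linear_into_bmo bounded_intervals T"
  shows "bmo_onorm dyadic_intervals T \<le> bmo_onorm bounded_intervals T"
proof (rule bmo_onorm_le)
  show "bmo_norm dyadic_intervals (T f) \<le> bmo_onorm bounded_intervals T * norm f" for f
    using T dyadic_bmo_norm_le[of "T f"] bmo_onorm_bound(1)[OF T, of f]
    by (auto simp: bounded_linear_into_bmo_def)
qed (rule bmo_onorm_bound(2)[OF T])

theorem proposition3p1:
  fixes T :: "'x::banach \<Rightarrow> real \<Rightarrow> 'b::{real_normed_field, euclidean_space}"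
  assumes "bounded_linear_into_bmo dyadic_intervals T"
  shows "(bounded_linear_into_bmo bounded_intervals T \<longleftrightarrow> (\<exists>M. adjacent_dyadic_bound T M))
    \<and> (bounded_linear_into_bmo bounded_intervals T \<longrightarrow>
         (\<exists>M. adjacent_dyadic_bound T M \<and>
              bmo_onorm bounded_intervals T = max (bmo_onorm dyadic_intervals T) M))
    \<and> (\<forall>M. adjacent_dyadic_bound T M \<longrightarrow>
         bmo_onorm bounded_intervals T \<le> 16 * max (bmo_onorm dyadic_intervals T) M)"
proof (intro conjI allI impI iffI)
  assume T: "bounded_linear_into_bmo bounded_intervals T"
  show "\<exists>M. adjacent_dyadic_bound T M"
    using adjacent_dyadic_bound_bmo_onorm[OF T] by blast
  show "\<exists>M. adjacent_dyadic_bound T M \<and>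
      bmo_onorm bounded_intervals T = max (bmo_onorm dyadic_intervals T) M"
    using adjacent_dyadic_bound_bmo_onorm[OF T] dyadic_bmo_onorm_le[OF T]
    by (intro exI[of _ "bmo_onorm bounded_intervals T"]) auto
next
  assume "\<exists>M. adjacent_dyadic_bound T M"
  then show "bounded_linear_into_bmo bounded_intervals T"
    using bounded_into_bmo_of_adjacent_dyadic_bound(1)[OF assms] by blast
next
  fix M assume "adjacent_dyadic_bound T M"
  then have "bmo_onorm bounded_intervals T \<le> 10 * max (bmo_onorm dyadic_intervals T) M"
    by (rule bounded_into_bmo_of_adjacent_dyadic_bound(2)[OF assms])
  then show "bmo_onorm bounded_intervals T \<le> 16 * max (bmo_onorm dyadic_intervals T) M"
    using bmo_onorm_bound(2)[OF assms] by linarith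
qed

end
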